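(* Fix $\alpha$ with $0 \leq \alpha < n$, and let $p(\cdot) \in \mathcal{P}(\mathbb{R}^n)$ satisfy $p_+\le\frac{n}{\alpha}$. Define $q(\cdot) \in \mathcal{P}(\mathbb{R}^n)$ by $\frac{1}{p(x)} - \frac{1}{q(x)} = \frac{\alpha}{n}$, $x\in\mathbb{R}^n$. Let $T_\alpha$ be a fractional Calderón-Zygmund operator with a non-degenerate kernel. If $T_\alpha : L^{p(\cdot)}(\mathbb{R}^n) \to L^{q(\cdot),\infty}(\mathbb{R}^n)$, then $p(\cdot) \in K_0^\alpha(\mathbb{R}^n)$.
   Context: Conventions: $1/\infty = 0$, and $n/\alpha=\infty$ when $\alpha=0$. $\mathcal{P}(\mathbb{R}^n)$ is the set of Lebesgue measurable functions $p(\cdot):\mathbb{R}^n\to[1,\infty]$ (exponent functions); $p_+=\operatorname{ess\,sup}_{x\in\mathbb{R}^n} p(x)$. The conjugate exponent $p'(\cdot)$ is defined pointwise by $\frac1{p(x)}+\frac1{p'(x)}=1$. Modular: with $\Omega_\infty=\{x\in\mathbb{R}^n: p(x)=\infty\}$, $\rho_{p(\cdot)}(f)=\int_{\mathbb{R}^n\setminus\Omega_\infty}|f(x)|^{p(x)}\,dx+\|f\|_{L^\infty(\Omega_\infty)}$. Norm: $\|f\|_{p(\cdot)}=\inf\{\lambda>0:\rho_{p(\cdot)}(f/\lambda)\le 1\}$. $L^{p(\cdot)}(\mathbb{R}^n)$ is the set of measurable $f$ with $\rho_{p(\cdot)}(f/\lambda)<\infty$ for some $\lambda>0$. Fractional Calderón-Zygmund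 operator: an operator $T_\alpha$, defined on measurable functions, that is bounded from $L^p(\mathbb{R}^n)$ to $L^q(\mathbb{R}^n)$ for some fixed $1<p\le q<\infty$ and such that for any $f\in L^p(\mathbb{R}^n)$ with compact support, $T_\alpha f(x)=\int_{\mathbb{R}^n}K_\alpha(x,y)f(y)\,dy$ for $x\notin\operatorname{supp}(f)$. Here the kernel $K_\alpha(x,y)$ is defined for all $(x,y)\in\mathbb{R}^n\times\mathbb{R}^n$, $x\ne y$, and for some constants $C_0$ and $\delta>0$ satisfies the size estimate $|K_\alpha(x,y)|\le \frac{C_0}{|x-y|^{n-\alpha}}$ and the smoothness estimate $|K_\alpha(x+h,y)-K_\alpha(x,y)|+|K_\alpha(x,y+h)-K_\alpha(x,y)|\le C_0\frac{|h|^\delta}{|x-y|^{n-\alpha+\delta}}$ for all $|h|<\frac12|x-y|$. Non-degenerate kernel: there exist $a>0$ and a unit vector $u_1$ such that $|K_\alpha(x,y)|\ge\frac{a}{|x-y|^{n-\alpha}}$ for all $x\neq y$ in $\mathbb{R}^n$ with $x-y=tu_1$ for some $t\in\mathbb{R}$. For an operator $T$, $T:L^{p(\cdot)}(\mathbb{R}^n)\to L^{q(\cdot),\infty}(\mathbb{R}^n)$ (weak $(p(\cdot),q(\cdot))$ inequality) means that there is a constant $C$ such that for every $\lambda>0$ and $f\in L^{p(\cdot)}(\mathbb{R}^n)$, $\|\chi_{\{x\in\mathbb{R}^n:|Tf(x)|>\lambda\}}\|_{q(\cdot)}\le \frac{C}{\lambda}\|f\|_{p(\cdot)}$. $p(\cdot)\in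 K_0^\alpha(\mathbb{R}^n)$ means $\sup_Q|Q|^{\frac{\alpha}{n}-1}\|\chi_Q\|_{p'(\cdot)}\|\chi_Q\|_{q(\cdot)}<\infty$, where the supremum is over cubes $Q\subset\mathbb{R}^n$ with sides parallel to the coordinate axes. *)

theory Defs
  imports "HOL-Analysis.Analysis" "HOL-Probability.Essential_Supremum"
begin

text \<open>
  The ambient space is \<open>real ^ 'n\<close>, so \<open>n = CARD('n)\<close>. Functions take values in a type
  \<open>'b :: {real_normed_field, euclidean_space}\<close>, so that real and complex scalars are both covered.
  Exponents live in \<open>ereal\<close>, where \<open>1 / \<infinity> = 0\<close> and \<open>c / 0 = \<infinity>\<close> for \<open>c > 0\<close>;
  modulars and norms live in \<open>ennreal\<close>.
\<close>

definition exponent_function :: "(real ^ 'n \<Rightarrow> ereal) \<Rightarrow> bool" where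
  "exponent_function p \<longleftrightarrow> p \<in> borel_measurable lebesgue \<and> (\<forall>x. 1 \<le> p x)"

definition conj_exponent :: "(real ^ 'n \<Rightarrow> ereal) \<Rightarrow> real ^ 'n \<Rightarrow> ereal" where
  "conj_exponent p x = 1 / (1 - 1 / p x)"

lemma conj_exponent_iff:
  assumes "1 \<le> p x" and "1 \<le> r"
  shows "1 / p x + 1 / r = 1 \<longleftrightarrow> r = conj_exponent p x"
proof (cases "p x")
  case (real a)
  then have a: "a \<ge> 1" using assms by simp
  show ?thesis
  proof (cases r)
    case (real b)
    then have "b \<ge> 1" using assms by simp
    then show ?thesis using \<open>p x = ereal a\<close> real a
      by (auto simp: conj_exponent_def one_ereal_def divide_ereal_def field_simps)
  qed (use real a assms in \<open>auto simp: conj_exponent_def one_ereal_def divide_ereal_def field_simps\<close>)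
next
  case PInf
  then show ?thesis using assms
    by (cases r) (auto simp: conj_exponent_def one_ereal_def divide_ereal_def field_simps)
qed (use assms in auto)

lemma conj_exponent_ge_1:
  assumes "1 \<le> p x"
  shows "1 \<le> conj_exponent p x"
  using assms
  by (cases "p x") (auto simp: conj_exponent_def one_ereal_def divide_ereal_def field_simps)

text \<open>The essential supremum of an \<open>ennreal\<close>-valued function over a null (or empty) set is \<open>0\<close>.\<close>

definition modular :: "(real ^ 'n \<Rightarrow> ereal) \<Rightarrow> (real ^ 'n \<Rightarrow> 'b::real_normed_vector) \<Rightarrow> ennreal" where
  "modular p f =
     (\<integral>\<^sup>+ x \<in> {x. p x \<noteq> \<infinity>}. ennreal (norm (f x) powr real_of_ereal (p x)) \<partial>lebesgue)
     + esssup (restrict_space lebesgue {x. p x = \<infinity>}) (\<lambda>x. ennreal (norm (f x)))"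

text \<open>The infimum is taken in \<open>ennreal\<close>, so it is \<open>\<infinity>\<close> when no \<open>l\<close> is admissible.\<close>

definition var_norm :: "(real ^ 'n \<Rightarrow> ereal) \<Rightarrow> (real ^ 'n \<Rightarrow> 'b::real_normed_vector) \<Rightarrow> ennreal" where
  "var_norm p f = Inf (ennreal ` {l. 0 < l \<and> modular p (\<lambda>x. f x /\<^sub>R l) \<le> 1})"

definition var_Lp :: "(real ^ 'n \<Rightarrow> ereal) \<Rightarrow> (real ^ 'n \<Rightarrow> 'b::real_normed_vector) set" where
  "var_Lp p = {f \<in> borel_measurable lebesgue. \<exists>l>0. modular p (\<lambda>x. f x /\<^sub>R l) < \<infinity>}"

definition Lp_space :: "real \<Rightarrow> (real ^ 'n \<Rightarrow> 'b::real_normed_vector) set" where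
  "Lp_space r = {f \<in> borel_measurable lebesgue. integrable lebesgue (\<lambda>x. norm (f x) powr r)}"

definition Lp_norm :: "real \<Rightarrow> (real ^ 'n \<Rightarrow> 'b::real_normed_vector) \<Rightarrow> real" where
  "Lp_norm r f = (LINT x|lebesgue. norm (f x) powr r) powr (1 / r)"

definition Lp_bounded ::
  "real \<Rightarrow> real \<Rightarrow> ((real ^ 'n \<Rightarrow> 'b::real_normed_vector) \<Rightarrow> real ^ 'n \<Rightarrow> 'b) \<Rightarrow> bool" where
  "Lp_bounded r s T \<longleftrightarrow>
     (\<exists>C. \<forall>f \<in> Lp_space r. T f \<in> Lp_space s \<and> Lp_norm s (T f) \<le> C * Lp_norm r f)"

text \<open>Only the values \<open>K x y\<close> with \<open>x \<noteq> y\<close> are constrained; in the smoothness estimate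
  \<open>x \<noteq> y\<close>, \<open>x + h \<noteq> y\<close> and \<open>x \<noteq> y + h\<close> follow from the condition on \<open>h\<close>.\<close>

definition frac_CZ_kernel :: "real \<Rightarrow> (real ^ 'n \<Rightarrow> real ^ 'n \<Rightarrow> 'b::real_normed_field) \<Rightarrow> bool" where
  "frac_CZ_kernel \<alpha> K \<longleftrightarrow>
     (\<exists>C0 \<delta>. \<delta> > 0 \<and>
        (\<forall>x y. x \<noteq> y \<longrightarrow> norm (K x y) \<le> C0 / norm (x - y) powr (real CARD('n) - \<alpha>)) \<and>
        (\<forall>x y h. norm h < norm (x - y) / 2 \<longrightarrow>
           norm (K (x + h) y - K x y) + norm (K x (y + h) - K x y)
             \<le> C0 * (norm h powr \<delta> / norm (x - y) powr (real CARD('n) - \<alpha> + \<delta>))))"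

definition nondegenerate_kernel ::
  "real \<Rightarrow> (real ^ 'n \<Rightarrow> real ^ 'n \<Rightarrow> 'b::real_normed_field) \<Rightarrow> bool" where
  "nondegenerate_kernel \<alpha> K \<longleftrightarrow>
     (\<exists>a>0. \<exists>u. norm u = 1 \<and>
        (\<forall>x y. x \<noteq> y \<longrightarrow> (\<exists>t. x - y = t *\<^sub>R u) \<longrightarrow>
           norm (K x y) \<ge> a / norm (x - y) powr (real CARD('n) - \<alpha>)))"

text \<open>\<open>T\<close> acts on functions, not on equivalence classes; linearity is not required.
  The support of \<open>f\<close> is \<open>closure {x. f x \<noteq> 0}\<close>.\<close>

definition frac_CZ_operator ::
  "real \<Rightarrow> (real ^ 'n \<Rightarrow> real ^ 'n \<Rightarrow> 'b::{real_normed_field, euclidean_space})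
     \<Rightarrow> ((real ^ 'n \<Rightarrow> 'b) \<Rightarrow> real ^ 'n \<Rightarrow> 'b) \<Rightarrow> bool" where
  "frac_CZ_operator \<alpha> K T \<longleftrightarrow>
     frac_CZ_kernel \<alpha> K \<and>
     (\<exists>r s. 1 < r \<and> r \<le> s \<and> Lp_bounded r s T \<and>
        (\<forall>f \<in> Lp_space r. compact (closure {x. f x \<noteq> 0}) \<longrightarrow>
           (\<forall>x. x \<notin> closure {x. f x \<noteq> 0} \<longrightarrow> T f x = (LINT y|lebesgue. K x y * f y))))"

definition weak_type ::
  "(real ^ 'n \<Rightarrow> ereal) \<Rightarrow> (real ^ 'n \<Rightarrow> ereal)
     \<Rightarrow> ((real ^ 'n \<Rightarrow> 'b::real_normed_vector) \<Rightarrow> real ^ 'n \<Rightarrow> 'b) \<Rightarrow> bool" where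
  "weak_type p q T \<longleftrightarrow>
     (\<exists>C\<ge>0. \<forall>l>0. \<forall>f \<in> var_Lp p.
        var_norm q (indicator {x. norm (T f x) > l} :: real ^ 'n \<Rightarrow> real)
          \<le> ennreal (C / l) * var_norm p f)"

definition cubes :: "(real ^ 'n) set set" where
  "cubes = {cbox a (\<chi> i. a $ i + l) | a l. 0 < l}"

definition K0_class :: "real \<Rightarrow> (real ^ 'n \<Rightarrow> ereal) \<Rightarrow> (real ^ 'n \<Rightarrow> ereal) \<Rightarrow> bool" where
  "K0_class \<alpha> p q \<longleftrightarrow>
     (SUP Q \<in> (cubes :: (real ^ 'n) set set).
        ennreal (measure lebesgue Q powr (\<alpha> / real CARD('n) - 1))
        * var_norm (conj_exponent p) (indicator Q :: real ^ 'n \<Rightarrow> real)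
        * var_norm q (indicator Q :: real ^ 'n \<Rightarrow> real)) < \<infinity>"

end

theory Submission
  imports Defs
begin

text \<open>
  Why a weak-type bound forces the \<open>K\<^sub>0\<close> condition. Given a cube \<open>Q\<close> of side \<open>l\<close>, move it a
  fixed large multiple of \<open>l\<close> in the direction in which the kernel is non-degenerate, and call the
  result \<open>Q'\<close>. Seen from so far away the kernel hardly varies on \<open>Q' \<times> Q\<close>: smoothness gives an
  oscillation that decays by an extra power of the distance, whereas non-degeneracy keeps the value
  at the corners of order \<open>l powr (\<alpha> - n)\<close>. There is thus no cancellation, and for every bounded
  \<open>g \<ge> 0\<close> living on \<open>Q\<close> the function \<open>T g\<close> is at least of order \<open>l powr (\<alpha> - n) * \<integral>g\<close> on all
  of \<open>Q'\<close>. Fed into the weak-type inequality, this is an averaging estimate (lemma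
  \<open>weak_type_far_cubes\<close>),

    \<open>l powr (\<alpha> - n) * \<integral>g * \<parallel>\<chi>\<^sub>Q\<^sub>'\<parallel>\<^sub>q \<le> D * \<parallel>g\<parallel>\<^sub>p\<close>,

  with \<open>D\<close> independent of the cube, and with \<open>Q\<close> and \<open>Q'\<close> interchangeable since the
  non-degeneracy holds along a whole line.

  The estimate is used twice. Letting \<open>g\<close> vary on \<open>Q\<close> and dualizing (lemma \<open>var_norm_conj_le\<close>)
  turns it into a bound for \<open>l powr (\<alpha> - n) * \<parallel>\<chi>\<^sub>Q\<parallel>\<^sub>p\<^sub>' * \<parallel>\<chi>\<^sub>Q\<^sub>'\<parallel>\<^sub>q\<close>, which is the required quantity
  except that one factor lives on the wrong cube. Interchanging the cubes and taking
  \<open>g = \<chi>\<^sub>Q\<^sub>'\<close> gives \<open>l powr \<alpha> * \<parallel>\<chi>\<^sub>Q\<parallel>\<^sub>q \<le> D * \<parallel>\<chi>\<^sub>Q\<^sub>'\<parallel>\<^sub>p\<close>; since \<open>1 / p = 1 / q + \<alpha> / n\<close>, Hoelder's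
  inequality (lemma \<open>var_norm_indicator_exponent_gap_le\<close>) bounds the right-hand side by a multiple
  of \<open>l powr \<alpha> * \<parallel>\<chi>\<^sub>Q\<^sub>'\<parallel>\<^sub>q\<close>. So \<open>\<parallel>\<chi>\<^sub>Q\<parallel>\<^sub>q\<close> is controlled by \<open>\<parallel>\<chi>\<^sub>Q\<^sub>'\<parallel>\<^sub>q\<close>, and the wrong cube can be replaced by
  the right one.
\<close>

section \<open>Cubes\<close>

definition cube :: "real ^ 'n \<Rightarrow> real \<Rightarrow> (real ^ 'n) set" where
  "cube a l = cbox a (\<chi> i. a $ i + l)"

lemma mem_cube: "x \<in> cube a l \<longleftrightarrow> (\<forall>i. a $ i \<le> x $ i \<and> x $ i \<le> a $ i + l)"
  by (simp add: cube_def mem_box_cart)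

lemma compact_cube: "compact (cube a l)"
  by (simp add: cube_def)

lemma cube_sets [measurable]: "cube a l \<in> sets lebesgue"
  by (simp add: cube_def)

lemma measure_cube:
  fixes a :: "real ^ 'n"
  assumes "0 < l"
  shows "measure lebesgue (cube a l) = l ^ CARD('n)"
proof -
  have "cube a l \<noteq> {}"
    using assms mem_cube[of a a l] by auto
  then show ?thesis
    by (simp add: cube_def content_cbox_cart)
qed

lemma emeasure_cube:
  fixes a :: "real ^ 'n"
  assumes "0 < l"
  shows "emeasure lebesgue (cube a l) = ennreal (l ^ CARD('n))"
  using measure_cube[OF assms, of a]
  by (simp add: cube_def emeasure_eq_measure2)

lemma norm_diff_cube_le:
  fixes a :: "real ^ 'n"
  assumes "x \<in> cube a l"
  shows "norm (x - a) \<le> real CARD('n) * l"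
proof -
  have "norm (x - a) \<le> (\<Sum>i\<in>UNIV. \<bar>(x - a) $ i\<bar>)"
    by (rule norm_le_l1_cart)
  also have "\<dots> \<le> (\<Sum>i\<in>(UNIV :: 'n set). l)"
    by (rule sum_mono) (use assms in \<open>auto simp: mem_cube abs_le_iff algebra_simps\<close>)
  finally show ?thesis by simp
qed

section \<open>The kernel on a pair of distant cubes\<close>

text \<open>
  The corners of the two cubes differ by a multiple of the distinguished direction, so
  \<open>K a b\<close> is bounded below by non-degeneracy. With \<open>D\<close> the dimension and \<open>t * l\<close> the distance of
  the corners, the smoothness estimate bounds the oscillation of \<open>K\<close> by a
  constant times \<open>(D * l) powr \<delta> / (t * l) powr (D - \<alpha> + \<delta>)\<close>, that is, by
  \<open>1 / t powr \<delta>\<close> times the order of \<open>K a b\<close>; a \<open>t\<close> that depends only on the kernel makes this at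
  most half of \<open>K a b\<close>. Both signs of the displacement are allowed because the two cubes
  have to exchange roles later.
\<close>

lemma kernel_comparable_on_far_cubes:
  fixes K :: "real ^ 'n \<Rightarrow> real ^ 'n \<Rightarrow> 'b::real_normed_field"
  assumes "\<alpha> < real CARD('n)" and "frac_CZ_kernel \<alpha> K" and "nondegenerate_kernel \<alpha> K"
  obtains c v where "0 < c"
    and "\<And>l a b x y. 0 < l \<Longrightarrow> a - b = l *\<^sub>R v \<or> b - a = l *\<^sub>R v \<Longrightarrow> x \<in> cube a l \<Longrightarrow> y \<in> cube b l
      \<Longrightarrow> x \<noteq> y \<and> 2 * norm (K x y - K a b) \<le> norm (K a b)
          \<and> 2 * c * l powr (\<alpha> - real CARD('n)) \<le> norm (K a b)"
proof -
  define D where "D = real CARD('n)"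
  have D: "1 \<le> D" unfolding D_def by (simp add: Suc_leI)
  define N where "N = D - \<alpha>"
  have N: "0 < N" using assms(1) by (simp add: N_def D_def)
  from assms(2) obtain C0 \<delta> where \<delta>: "0 < \<delta>"
    and smooth0: "\<And>x y h. norm h < norm (x - y) / 2 \<Longrightarrow>
           norm (K (x + h) y - K x y) + norm (K x (y + h) - K x y)
             \<le> C0 * (norm h powr \<delta> / norm (x - y) powr (N + \<delta>))"
    unfolding frac_CZ_kernel_def N_def D_def by blast
  from assms(3) obtain k u where k: "0 < k" and u: "norm u = 1"
    and lower: "\<And>x y t. x \<noteq> y \<Longrightarrow> x - y = t *\<^sub>R u \<Longrightarrow> k / norm (x - y) powr N \<le> norm (K x y)"
    unfolding nondegenerate_kernel_def N_def D_def by blast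
  \<comment> \<open>The constant of the kernel estimates has no prescribed sign; monotonicity arguments need a
    positive one.\<close>
  define C where "C = \<bar>C0\<bar> + 1"
  have C: "0 < C" "C0 \<le> C" by (auto simp: C_def)
  have smooth: "norm (K (x + h) y - K x y) + norm (K x (y + h) - K x y)
             \<le> C * (r powr \<delta> / s powr (N + \<delta>))"
    if "norm h < norm (x - y) / 2" "norm h \<le> r" "s \<le> norm (x - y)" "0 < s" for x y h r s
  proof -
    have "C0 * (norm h powr \<delta> / norm (x - y) powr (N + \<delta>)) \<le> C * (r powr \<delta> / s powr (N + \<delta>))"
      using that C \<delta> N by (intro mult_mono frac_le powr_mono2) auto
    then show ?thesis using smooth0[OF that(1)] by linarith
  qed
  \<comment> \<open>The value that \<open>t powr \<delta>\<close> must exceed for the oscillation to be at most half of the lower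
    bound. The factor \<open>2 powr (N + \<delta>)\<close> comes from the first of two moves: it starts from
    the pair \<open>a, y\<close>, whose distance is only known to be at least half of that of \<open>a, b\<close>.\<close>
  define E where "E = 2 * C * D powr \<delta> * (2 powr (N + \<delta>) + 1) / k"
  have E: "0 < E" using C D k by (simp add: E_def add_pos_pos)
  \<comment> \<open>The summand \<open>4 * D\<close> separates the cubes and makes each displacement less than half the
    distance, as the smoothness estimate demands.\<close>
  define t where "t = 4 * D + E powr (1 / \<delta>)"
  have t: "4 * D \<le> t" "0 < t" using D by (auto simp: t_def intro: add_pos_nonneg)
  have tE: "E \<le> t powr \<delta>"
  proof -
    have "E = (E powr (1 / \<delta>)) powr \<delta>" using E \<delta> by (simp add: powr_powr)
    also have "\<dots> \<le> t powr \<delta>" using D \<delta> by (intro powr_mono2) (auto simp: t_def)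
    finally show ?thesis .
  qed
  define c where "c = k / (2 * t powr N)"
  have c: "0 < c" using k t by (simp add: c_def)
  show ?thesis
  proof (rule that[of c "t *\<^sub>R u", OF c])
    fix l :: real and a b x y :: "real ^ 'n"
    assume l: "0 < l" and ab: "a - b = l *\<^sub>R t *\<^sub>R u \<or> b - a = l *\<^sub>R t *\<^sub>R u"
      and x: "x \<in> cube a l" and y: "y \<in> cube b l"
    define m where "m = t * l"
    have m: "0 < m" using t l by (simp add: m_def)
    have Dl: "4 * (D * l) \<le> m" "0 < D * l" using t l D by (auto simp: m_def)
    have "norm (a - b) = norm (l *\<^sub>R t *\<^sub>R u)"
      using ab norm_minus_commute[of a b] by auto
    then have nab: "norm (a - b) = m"
      using u l t by (simp add: m_def)
    have nx: "norm (x - a) \<le> D * l" and ny: "norm (y - b) \<le> D * l"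
      using norm_diff_cube_le[OF x] norm_diff_cube_le[OF y] by (auto simp: D_def)
    have "norm (a - b) \<le> norm (a - y) + norm (y - b)"
      using norm_triangle_ineq[of "a - y" "y - b"] by simp
    then have nay: "m - D * l \<le> norm (a - y)" using nab ny by linarith
    have "norm (a - y) \<le> norm (x - y) + norm (x - a)"
      using norm_triangle_ineq4[of "x - y" "x - a"] by simp
    then have "0 < norm (x - y)" using nay nx Dl by linarith
    then have xy: "x \<noteq> y" by auto
    have "norm (K x y - K a y) \<le> C * ((D * l) powr \<delta> / (m / 2) powr (N + \<delta>))"
      using smooth[of "x - a" a y "D * l" "m / 2"] nx nay Dl m norm_ge_zero[of "K a (y + (x - a)) - K a y"]
      by (simp del: norm_ge_zero)
    moreover have "norm (K a y - K a b) \<le> C * ((D * l) powr \<delta> / m powr (N + \<delta>))"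
      using smooth[of "y - b" a b "D * l" m] ny nab Dl m norm_ge_zero[of "K (a + (y - b)) b - K a b"]
      by (simp del: norm_ge_zero)
    moreover have "norm (K x y - K a b) \<le> norm (K x y - K a y) + norm (K a y - K a b)"
      using norm_triangle_ineq[of "K x y - K a y" "K a y - K a b"] by simp
    ultimately have "norm (K x y - K a b)
        \<le> C * ((D * l) powr \<delta> / (m / 2) powr (N + \<delta>)) + C * ((D * l) powr \<delta> / m powr (N + \<delta>))"
      by linarith
    also have "\<dots> = (k / 2) * E * l powr \<delta> / m powr (N + \<delta>)"
      using C D k l m by (simp add: E_def powr_mult powr_divide field_simps)
    also have "\<dots> = (k / 2) * (E / t powr \<delta>) / m powr N"
      using t l by (simp add: m_def powr_mult powr_add field_simps)
    also have "\<dots> \<le> (k / 2) * 1 / m powr N"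
      using tE k t by (intro divide_right_mono mult_left_mono) auto
    finally have close: "2 * norm (K x y - K a b) \<le> k / m powr N" by simp
    have "\<exists>s. a - b = s *\<^sub>R u"
      using ab by (metis minus_diff_eq scaleR_minus_left scaleR_scaleR)
    moreover have "a \<noteq> b" using nab m by auto
    ultimately have low: "k / m powr N \<le> norm (K a b)" using lower nab by metis
    have "2 * c * l powr (- N) = k / m powr N"
      using t l by (simp add: c_def m_def powr_mult powr_minus field_simps)
    then have "2 * c * l powr (\<alpha> - real CARD('n)) \<le> norm (K a b)"
      using low by (simp add: N_def D_def)
    then show "x \<noteq> y \<and> 2 * norm (K x y - K a b) \<le> norm (K a b)
          \<and> 2 * c * l powr (\<alpha> - real CARD('n)) \<le> norm (K a b)"
      using xy close low by auto
  qed
qed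

section \<open>Lower bounds for the operator on nonnegative functions\<close>

text \<open>
  Bounded functions on a cube lie in every Lebesgue space, with constant or variable exponent.
  They can hence be inserted both into the integral representation, which is only available on
  \<open>L\<^sup>r\<close>, and into the weak-type inequality.
\<close>

definition test_function :: "(real ^ 'n) set \<Rightarrow> (real ^ 'n \<Rightarrow> real) \<Rightarrow> bool" where
  "test_function Q g \<longleftrightarrow> g \<in> borel_measurable lebesgue \<and> (\<exists>B. \<forall>x. g x \<le> B)
     \<and> (\<forall>x. 0 \<le> g x) \<and> (\<forall>x. x \<notin> Q \<longrightarrow> g x = 0)"

text \<open>
  Measurability of the kernel is not among its axioms; away from the diagonal it follows from
  the smoothness estimate. Without it the integral of \<open>K x y * f y\<close> might be the
  default value \<open>0\<close>, and no lower bound could hold.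
\<close>

lemma continuous_on_kernel_snd:
  fixes K :: "real ^ 'n \<Rightarrow> real ^ 'n \<Rightarrow> 'b::real_normed_field"
  assumes "frac_CZ_kernel \<alpha> K" and "x \<notin> S"
  shows "continuous_on S (K x)"
proof -
  from assms(1) obtain C0 \<delta> where \<delta>: "0 < \<delta>"
    and smooth: "\<And>x y h. norm h < norm (x - y) / 2 \<Longrightarrow>
           norm (K (x + h) y - K x y) + norm (K x (y + h) - K x y)
             \<le> C0 * (norm h powr \<delta> / norm (x - y) powr (real CARD('n) - \<alpha> + \<delta>))"
    unfolding frac_CZ_kernel_def by blast
  have "isCont (K x) y" if "y \<in> S" for y
  proof -
    have ne: "0 < norm (x - y)" using assms(2) that by auto
    have "\<forall>\<^sub>F h in at 0. norm (K x (y + h) - K x y)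
        \<le> C0 * (norm h powr \<delta> / norm (x - y) powr (real CARD('n) - \<alpha> + \<delta>))"
      unfolding eventually_at
    proof (intro exI[of _ "norm (x - y) / 2"] conjI ballI impI)
      fix h :: "real ^ 'n" assume "h \<noteq> 0 \<and> dist h 0 < norm (x - y) / 2"
      then show "norm (K x (y + h) - K x y)
        \<le> C0 * (norm h powr \<delta> / norm (x - y) powr (real CARD('n) - \<alpha> + \<delta>))"
        using smooth[of h x y] norm_ge_zero[of "K (x + h) y - K x y"]
        by (simp del: norm_ge_zero)
    qed (use ne in auto)
    moreover have "((\<lambda>h::real^'n. C0 * (norm h powr \<delta> / norm (x - y) powr (real CARD('n) - \<alpha> + \<delta>))) \<longlongrightarrow>
        C0 * (0 powr \<delta> / norm (x - y) powr (real CARD('n) - \<alpha> + \<delta>))) (at 0)"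
      using \<delta> ne by (intro tendsto_intros tendsto_norm_zero) auto
    then have "((\<lambda>h::real^'n. C0 * (norm h powr \<delta> / norm (x - y) powr (real CARD('n) - \<alpha> + \<delta>))) \<longlongrightarrow> 0) (at 0)"
      by simp
    ultimately have "((\<lambda>h. K x (y + h) - K x y) \<longlongrightarrow> 0) (at 0)"
      by (rule Lim_null_comparison)
    then show ?thesis
      by (simp add: isCont_iff LIM_zero_iff)
  qed
  then show ?thesis
    by (simp add: continuous_at_imp_continuous_on)
qed

lemma test_function_cmult:
  assumes "0 \<le> c" and "test_function Q g"
  shows "test_function Q (\<lambda>x. c * g x)"
proof -
  obtain B where "\<And>x. g x \<le> B" using assms(2) by (auto simp: test_function_def)
  then have "\<And>x. c * g x \<le> c * B" using assms(1) by (simp add: mult_left_mono)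
  then show ?thesis using assms unfolding test_function_def by auto
qed

lemma integrable_test_function:
  assumes "compact Q" and "test_function Q g"
  shows "integrable lebesgue g"
proof -
  obtain B where "\<And>x. g x \<le> B" using assms(2) by (auto simp: test_function_def)
  moreover have "emeasure lebesgue Q < \<infinity>"
    using fmeasurableD2[OF lmeasurable_compact[OF assms(1)]] by (simp add: top.not_eq_extremum)
  ultimately show ?thesis
    using assms by (intro integrableI_bounded_set[of Q _ _ B])
       (auto simp: test_function_def compact_imp_closed borel_closed)
qed

text \<open>
  Replacing \<open>K x y\<close> by the constant \<open>k\<close> changes the integral by at most
  \<open>norm k / 2 * \<integral>g\<close>, while \<open>norm (k * \<integral>g) = norm k * \<integral>g\<close> because \<open>g \<ge> 0\<close>.
\<close>

lemma kernel_integral_lower_bound: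
  fixes K :: "real ^ 'n \<Rightarrow> real ^ 'n \<Rightarrow> 'b::{real_normed_field, euclidean_space}"
  assumes K: "frac_CZ_kernel \<alpha> K" and Q: "compact Q" and x: "x \<notin> Q" and g: "test_function Q g"
    and close: "\<And>y. y \<in> Q \<Longrightarrow> 2 * norm (K x y - k) \<le> norm k"
  shows "norm k / 2 * (LINT y|lebesgue. g y) \<le> norm (LINT y|lebesgue. K x y * of_real (g y))"
proof -
  have gi: "integrable lebesgue g" by (rule integrable_test_function[OF Q g])
  have g0: "0 \<le> g y" "y \<notin> Q \<Longrightarrow> g y = 0" for y using g by (auto simp: test_function_def)
  have Qb: "Q \<in> sets borel" using Q by (simp add: compact_imp_closed)
  have "(\<lambda>y. indicator Q y *\<^sub>R K x y) \<in> borel_measurable lborel"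
    unfolding measurable_lborel2
    by (intro borel_measurable_continuous_on_indicator Qb continuous_on_kernel_snd[OF K x])
  then have [measurable]: "(\<lambda>y. indicator Q y *\<^sub>R K x y) \<in> borel_measurable lebesgue"
    by (rule measurable_completion)
  have [measurable]: "g \<in> borel_measurable lebesgue" using gi by auto
  have [measurable]: "Q \<in> sets lebesgue" using Qb by auto
  have meas: "(\<lambda>y. (K x y - k) * of_real (g y)) \<in> borel_measurable lebesgue"
  proof -
    have "(\<lambda>y. (K x y - k) * of_real (g y)) = (\<lambda>y. g y *\<^sub>R (indicator Q y *\<^sub>R K x y - k))"
      by (auto simp: fun_eq_iff indicator_def g0 scaleR_conv_of_real mult.commute)
    then show ?thesis by simp
  qed
  have bnd: "norm ((K x y - k) * of_real (g y)) \<le> norm k / 2 * g y" for y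
    using mult_right_mono[OF close[of y] g0(1)[of y]] g0[of y]
    by (cases "y \<in> Q") (auto simp: norm_mult mult_ac)
  have int1: "integrable lebesgue (\<lambda>y. (K x y - k) * of_real (g y))"
    by (rule Bochner_Integration.integrable_bound[OF integrable_mult_right[OF gi, of "norm k / 2"] meas])
       (use bnd g0 in \<open>auto simp: abs_mult\<close>)
  have int2: "integrable lebesgue (\<lambda>y. k * of_real (g y))"
    using gi by simp
  have "(LINT y|lebesgue. K x y * of_real (g y))
      = (LINT y|lebesgue. (K x y - k) * of_real (g y) + k * of_real (g y))"
    by (simp add: algebra_simps)
  also have "\<dots> = (LINT y|lebesgue. (K x y - k) * of_real (g y)) + k * of_real (LINT y|lebesgue. g y)"
    using int1 int2 gi by (subst Bochner_Integration.integral_add) auto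
  finally have eq: "(LINT y|lebesgue. K x y * of_real (g y)) = \<dots>" .
  have "norm (LINT y|lebesgue. (K x y - k) * of_real (g y)) \<le> (LINT y|lebesgue. norm k / 2 * g y)"
    by (rule Bochner_Integration.integral_norm_bound_integral[OF int1 integrable_mult_right[OF gi] bnd])
  then have le: "norm (LINT y|lebesgue. (K x y - k) * of_real (g y)) \<le> norm k / 2 * (LINT y|lebesgue. g y)"
    by simp
  have "0 \<le> (LINT y|lebesgue. g y)" using g0 by (simp add: integral_nonneg_AE)
  then have "norm (k * of_real (LINT y|lebesgue. g y)) = norm k * (LINT y|lebesgue. g y)"
    by (simp add: norm_mult)
  moreover have "norm (k * of_real (LINT y|lebesgue. g y)) \<le>
     norm (LINT y|lebesgue. K x y * of_real (g y)) + norm (LINT y|lebesgue. (K x y - k) * of_real (g y))"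
    unfolding eq
    using norm_triangle_ineq4[of "(LINT y|lebesgue. (K x y - k) * of_real (g y)) + k * of_real (LINT y|lebesgue. g y)"
        "LINT y|lebesgue. (K x y - k) * of_real (g y)"]
    by (simp only: add_diff_cancel_left')
  ultimately show ?thesis using le by linarith
qed

lemma frac_CZ_operator_lower_bound:
  fixes K :: "real ^ 'n \<Rightarrow> real ^ 'n \<Rightarrow> 'b::{real_normed_field, euclidean_space}"
  assumes T: "frac_CZ_operator \<alpha> K T" and Q: "compact Q" and x: "x \<notin> Q" and g: "test_function Q g"
    and close: "\<And>y. y \<in> Q \<Longrightarrow> 2 * norm (K x y - k) \<le> norm k"
  shows "norm k / 2 * (LINT y|lebesgue. g y) \<le> norm (T (\<lambda>y. of_real (g y)) x)"
proof -
  obtain r where r: "1 < r" and repr: "\<And>f x. f \<in> Lp_space r \<Longrightarrow> compact (closure {x. f x \<noteq> 0}) \<Longrightarrow>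
           x \<notin> closure {x. f x \<noteq> 0} \<Longrightarrow> T f x = (LINT y|lebesgue. K x y * f y)"
    using T unfolding frac_CZ_operator_def by blast
  have gm [measurable]: "g \<in> borel_measurable lebesgue" and g0: "\<And>y. 0 \<le> g y" "\<And>y. y \<notin> Q \<Longrightarrow> g y = 0"
    using g by (auto simp: test_function_def)
  obtain B where B: "\<And>y. g y \<le> B" using g by (auto simp: test_function_def)
  have "test_function Q (\<lambda>y. g y powr r)"
    unfolding test_function_def
  proof (intro conjI exI allI)
    show "g y powr r \<le> B powr r" for y using r g0 B by (intro powr_mono2) auto
  qed (use g0 in auto)
  from integrable_test_function[OF Q this]
  have Lp: "(\<lambda>y. of_real (g y)) \<in> (Lp_space r :: (real ^ 'n \<Rightarrow> 'b) set)"
    using g0 by (simp add: Lp_space_def)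
  have "{y. (of_real (g y) :: 'b) \<noteq> 0} \<subseteq> Q" using g0 by auto
  then have cl: "closure {y. (of_real (g y) :: 'b) \<noteq> 0} \<subseteq> Q"
    using Q by (simp add: closure_minimal compact_imp_closed)
  then have "compact (closure {y. (of_real (g y) :: 'b) \<noteq> 0})"
    using Q by (metis closed_closure compact_Int_closed inf.absorb_iff2)
  then have "T (\<lambda>y. of_real (g y)) x = (LINT y|lebesgue. K x y * of_real (g y))"
    using repr[OF Lp] cl x by blast
  then show ?thesis
    using kernel_integral_lower_bound[of \<alpha> K Q x g k] Q x g close T by (simp add: frac_CZ_operator_def)
qed

section \<open>Modulars and norms with variable exponent\<close>

lemma exponent_infinite_sets [measurable]:
  fixes p :: "real ^ 'n \<Rightarrow> ereal"
  assumes [measurable]: "p \<in> borel_measurable lebesgue"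
  shows "{x. p x = \<infinity>} \<in> sets lebesgue" "{x. p x \<noteq> \<infinity>} \<in> sets lebesgue"
proof -
  have "{x \<in> space lebesgue. p x = \<infinity>} \<in> sets lebesgue" "{x \<in> space lebesgue. p x \<noteq> \<infinity>} \<in> sets lebesgue"
    by measurable
  then show "{x. p x = \<infinity>} \<in> sets lebesgue" "{x. p x \<noteq> \<infinity>} \<in> sets lebesgue"
    by simp_all
qed

text \<open>
  The essential supremum in the modular is taken over a restricted measure space; this lemma and
  the next allow it to be handled through almost-everywhere statements on the whole space.
\<close>

lemma modular_le:
  fixes f :: "real ^ 'n \<Rightarrow> 'b::real_normed_vector"
  assumes p [measurable]: "p \<in> borel_measurable lebesgue" and f [measurable]: "f \<in> borel_measurable lebesgue"
    and "(\<integral>\<^sup>+ x \<in> {x. p x \<noteq> \<infinity>}. ennreal (norm (f x) powr real_of_ereal (p x)) \<partial>lebesgue) \<le> A"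
    and "AE x in lebesgue. p x = \<infinity> \<longrightarrow> ennreal (norm (f x)) \<le> B"
    and "A + B \<le> L"
  shows "modular p f \<le> L"
proof -
  have "AE x in restrict_space lebesgue {x. p x = \<infinity>}. ennreal (norm (f x)) \<le> B"
    using assms(4) by (simp add: AE_restrict_space_iff)
  moreover have "(\<lambda>x. ennreal (norm (f x))) \<in> borel_measurable (restrict_space lebesgue {x. p x = \<infinity>})"
    by (rule measurable_restrict_space1) measurable
  ultimately have "esssup (restrict_space lebesgue {x. p x = \<infinity>}) (\<lambda>x. ennreal (norm (f x))) \<le> B"
    by (intro esssup_I)
  then have "modular p f \<le> A + B"
    unfolding modular_def using assms(3) by (intro add_mono)
  then show ?thesis using assms(5) by (rule order_trans)
qed

lemma AE_le_modular_esssup: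
  fixes p :: "real ^ 'n \<Rightarrow> ereal" and f :: "real ^ 'n \<Rightarrow> 'b::real_normed_vector"
  assumes [measurable]: "p \<in> borel_measurable lebesgue"
  shows "AE x in lebesgue. p x = \<infinity> \<longrightarrow> ennreal (norm (f x))
     \<le> esssup (restrict_space lebesgue {x. p x = \<infinity>}) (\<lambda>x. ennreal (norm (f x)))"
  using esssup_AE[where f = "\<lambda>x. ennreal (norm (f x))" and M = "restrict_space lebesgue {x. p x = \<infinity>}"]
  by (simp add: AE_restrict_space_iff exponent_infinite_sets(1)[OF assms])

lemma var_norm_le:
  assumes "0 < l" and "modular p (\<lambda>x. f x /\<^sub>R l) \<le> 1"
  shows "var_norm p f \<le> ennreal l"
  unfolding var_norm_def using assms by (intro Inf_lower) auto

lemma modular_mono: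
  assumes "g \<in> borel_measurable lebesgue" and "\<And>x. norm (g x) \<le> norm (f x)" and "\<And>x. 0 \<le> p x"
  shows "modular p g \<le> modular p f"
  unfolding modular_def
proof (rule add_mono)
  show "(\<integral>\<^sup>+ x \<in> {x. p x \<noteq> \<infinity>}. ennreal (norm (g x) powr real_of_ereal (p x)) \<partial>lebesgue)
     \<le> (\<integral>\<^sup>+ x \<in> {x. p x \<noteq> \<infinity>}. ennreal (norm (f x) powr real_of_ereal (p x)) \<partial>lebesgue)"
    using assms(2,3)
    by (intro nn_integral_mono mult_right_mono ennreal_leI powr_mono2) (auto simp: real_of_ereal_pos)
  show "esssup (restrict_space lebesgue {x. p x = \<infinity>}) (\<lambda>x. ennreal (norm (g x)))
     \<le> esssup (restrict_space lebesgue {x. p x = \<infinity>}) (\<lambda>x. ennreal (norm (f x)))"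
    using assms(1,2) by (intro esssup_mono measurable_restrict_space1) (auto intro: ennreal_leI)
qed

lemma var_norm_mono:
  fixes f g :: "real ^ 'n \<Rightarrow> 'b::real_normed_vector"
  assumes g [measurable]: "g \<in> borel_measurable lebesgue"
    and le: "\<And>x. norm (g x) \<le> norm (f x)" and p: "\<And>x. 0 \<le> p x"
  shows "var_norm p g \<le> var_norm p f"
  unfolding var_norm_def
proof (intro Inf_superset_mono image_mono Collect_mono impI)
  fix l :: real
  assume l: "0 < l \<and> modular p (\<lambda>x. f x /\<^sub>R l) \<le> 1"
  have "modular p (\<lambda>x. g x /\<^sub>R l) \<le> modular p (\<lambda>x. f x /\<^sub>R l)"
    using l le p by (intro modular_mono) (auto intro!: mult_left_mono)
  then show "0 < l \<and> modular p (\<lambda>x. g x /\<^sub>R l) \<le> 1"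
    using l by auto
qed

lemma modular_cong_norm:
  assumes "\<And>x. norm (f x) = norm (g x)"
  shows "modular p f = modular p g"
  using assms by (simp add: modular_def)

lemma var_norm_cong_norm:
  assumes "\<And>x. norm (f x) = norm (g x)"
  shows "var_norm p f = var_norm p g"
proof -
  have "modular p (\<lambda>x. f x /\<^sub>R l) = modular p (\<lambda>x. g x /\<^sub>R l)" for l
    by (rule modular_cong_norm) (simp add: assms)
  then show ?thesis by (simp add: var_norm_def)
qed

text \<open>
  Exponents are at least \<open>1\<close>, so \<open>(1 / l) powr p \<le> 1 / l\<close> for \<open>l \<ge> 1\<close>. This convexity property
  turns a bound for the modular into one for the norm.
\<close>

lemma modular_scale_le:
  fixes f :: "real ^ 'n \<Rightarrow> 'b::real_normed_vector"
  assumes p: "exponent_function p" and f [measurable]: "f \<in> borel_measurable lebesgue" and "1 \<le> l"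
  shows "modular p (\<lambda>x. f x /\<^sub>R l) \<le> ennreal (inverse l) * modular p f"
proof -
  have [measurable]: "p \<in> borel_measurable lebesgue" and p1: "\<And>x. 1 \<le> p x"
    using p by (auto simp: exponent_function_def)
  show ?thesis
  proof (rule modular_le)
    have scale: "(norm (f x /\<^sub>R l)) powr r \<le> inverse l * norm (f x) powr r" if "1 \<le> r" for x r
    proof -
      have "inverse l powr r \<le> inverse l powr 1"
        using that assms(3) by (intro powr_mono') (auto simp: inverse_le_1_iff)
      then show ?thesis using assms(3) by (simp add: powr_mult mult_right_mono)
    qed
    have "1 \<le> real_of_ereal (p x)" if "p x \<noteq> \<infinity>" for x
      using p1[of x] that by (cases "p x") auto
    then have "(\<integral>\<^sup>+ x \<in> {x. p x \<noteq> \<infinity>}. ennreal (norm (f x /\<^sub>R l) powr real_of_ereal (p x)) \<partial>lebesgue)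
       \<le> (\<integral>\<^sup>+ x. ennreal (inverse l) * (ennreal (norm (f x) powr real_of_ereal (p x)) * indicator {x. p x \<noteq> \<infinity>} x) \<partial>lebesgue)"
      using scale assms(3)
      by (intro nn_integral_mono) (auto simp: indicator_def ennreal_mult'[symmetric] intro!: ennreal_leI)
    then show "(\<integral>\<^sup>+ x \<in> {x. p x \<noteq> \<infinity>}. ennreal (norm (f x /\<^sub>R l) powr real_of_ereal (p x)) \<partial>lebesgue)
      \<le> ennreal (inverse l) * (\<integral>\<^sup>+ x \<in> {x. p x \<noteq> \<infinity>}. ennreal (norm (f x) powr real_of_ereal (p x)) \<partial>lebesgue)"
      by (subst (asm) nn_integral_cmult) auto
    show "AE x in lebesgue. p x = \<infinity> \<longrightarrow> ennreal (norm (f x /\<^sub>R l))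
        \<le> ennreal (inverse l) * esssup (restrict_space lebesgue {x. p x = \<infinity>}) (\<lambda>x. ennreal (norm (f x)))"
      using AE_le_modular_esssup[of p f]
      by (rule AE_mp) (use assms(3) in \<open>auto simp: ennreal_mult' intro!: mult_left_mono\<close>)
  qed (auto simp: modular_def distrib_left)
qed

lemma var_norm_le_of_modular_le:
  fixes f :: "real ^ 'n \<Rightarrow> 'b::real_normed_vector"
  assumes "exponent_function p" and "f \<in> borel_measurable lebesgue" and "1 \<le> l"
    and "modular p f \<le> ennreal l"
  shows "var_norm p f \<le> ennreal l"
proof (rule var_norm_le)
  have "modular p (\<lambda>x. f x /\<^sub>R l) \<le> ennreal (inverse l) * ennreal l"
    using modular_scale_le[OF assms(1-3)] assms(4) by (meson mult_left_mono order_trans zero_le)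
  then show "modular p (\<lambda>x. f x /\<^sub>R l) \<le> 1"
    using assms(3) by (simp add: ennreal_mult'[symmetric])
qed (use assms in auto)

text \<open>
  Where the exponent is unbounded, a function exceeding \<open>1\<close> may have infinite modular even if it
  is bounded with compact support; bounded functions are therefore scaled below \<open>1\<close> first.
\<close>

lemma modular_bounded_by_one_le:
  fixes f :: "real ^ 'n \<Rightarrow> 'b::real_normed_vector"
  assumes p: "exponent_function p" and f [measurable]: "f \<in> borel_measurable lebesgue"
    and Q [measurable]: "Q \<in> sets lebesgue"
    and f1: "\<And>x. norm (f x) \<le> 1" and fQ: "\<And>x. x \<notin> Q \<Longrightarrow> f x = 0"
  shows "modular p f \<le> emeasure lebesgue Q + 1"
proof (rule modular_le)
  show "p \<in> borel_measurable lebesgue" using p by (auto simp: exponent_function_def)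
  have p0: "0 \<le> real_of_ereal (p x)" for x
    using p order_trans[of 0 1 "p x"] by (auto simp: exponent_function_def intro!: real_of_ereal_pos)
  have le: "norm (f x) powr real_of_ereal (p x) \<le> indicator Q x" for x
    using powr_mono2[OF p0 norm_ge_zero f1, of x] fQ[of x] by (auto simp: indicator_def)
  have "(\<integral>\<^sup>+ x \<in> {x. p x \<noteq> \<infinity>}. ennreal (norm (f x) powr real_of_ereal (p x)) \<partial>lebesgue)
      \<le> (\<integral>\<^sup>+ x. indicator Q x \<partial>lebesgue)"
  proof (rule nn_integral_mono)
    fix x
    show "ennreal (norm (f x) powr real_of_ereal (p x)) * indicator {x. p x \<noteq> \<infinity>} x \<le> indicator Q x"
      using ennreal_leI[OF le[of x]] by (auto simp: indicator_def split: if_splits)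
  qed
  then show "(\<integral>\<^sup>+ x \<in> {x. p x \<noteq> \<infinity>}. ennreal (norm (f x) powr real_of_ereal (p x)) \<partial>lebesgue)
      \<le> emeasure lebesgue Q" by simp
qed (use f1 in auto)

lemma test_function_in_var_Lp:
  fixes g :: "real ^ 'n \<Rightarrow> real"
  assumes p: "exponent_function p" and Q: "compact Q" and g: "test_function Q g"
  shows "(\<lambda>x. of_real (g x)) \<in> (var_Lp p :: (real ^ 'n \<Rightarrow> 'b::{real_normed_algebra_1, euclidean_space}) set)"
proof -
  have [measurable]: "g \<in> borel_measurable lebesgue" using g by (simp add: test_function_def)
  obtain B where B: "\<And>x. g x \<le> B" using g by (auto simp: test_function_def)
  have g0: "\<And>x. 0 \<le> g x" using g by (simp add: test_function_def)
  have B0: "0 \<le> B" using order_trans[OF g0 B] .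
  have "modular p (\<lambda>x. (of_real (g x) :: 'b) /\<^sub>R (B + 1)) \<le> emeasure lebesgue Q + 1"
  proof (rule modular_bounded_by_one_le[OF p])
    fix x
    have "g x \<le> B + 1" using B[of x] by linarith
    then show "norm ((of_real (g x) :: 'b) /\<^sub>R (B + 1)) \<le> 1"
      using g0[of x] B0 by (simp add: field_simps)
  qed (use g Q in \<open>auto simp: test_function_def compact_imp_closed borel_closed\<close>)
  also have "\<dots> < \<infinity>"
    using fmeasurableD2[OF lmeasurable_compact[OF Q]] by (simp add: less_top)
  finally show ?thesis
    unfolding var_Lp_def using B0 by (auto intro!: exI[of _ "B + 1"])
qed

lemma measurable_conj_exponent:
  fixes p :: "real ^ 'n \<Rightarrow> ereal"
  assumes [measurable]: "p \<in> borel_measurable lebesgue"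
  shows "conj_exponent p \<in> borel_measurable lebesgue"
  unfolding conj_exponent_def[abs_def] by (intro borel_measurable_ereal_divide borel_measurable_ereal_diff) auto

section \<open>The conjugate norm of an indicator by duality\<close>

text \<open>
  On \<open>{p > 1}\<close>, test the hypothesis with \<open>g = m powr (1 - p')\<close>, where \<open>m = 3 * A\<close>, cut off where \<open>p'\<close> is
  large. As \<open>(p' - 1) * p = p'\<close>, both \<open>\<integral>g = m * S\<close> and the finite part of the modular of \<open>g\<close> are
  governed by the same number \<open>S = \<integral>m powr (- p')\<close>, and so \<open>m * S \<le> A * (S + 1)\<close>, which forces
  \<open>S \<le> 1 / 2\<close>. Removing the cut-off gives half of the modular of \<open>\<chi>\<^sub>Q / m\<close>. The other half is the
  essential supremum over \<open>{p' = \<infinity>} = {p = 1}\<close>: if this set has positive measure in \<open>Q\<close>, its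
  indicator is a test function showing \<open>A \<ge> 1\<close>, hence \<open>1 / m \<le> 1 / 3\<close>.
\<close>

lemma var_norm_conj_le:
  fixes p :: "real ^ 'n \<Rightarrow> ereal"
  assumes p: "exponent_function p" and Q: "compact Q" and A: "0 < A"
    and dual: "\<And>g. test_function Q g \<Longrightarrow> ennreal (LINT x|lebesgue. g x) \<le> ennreal A * var_norm p g"
  shows "var_norm (conj_exponent p) (indicator Q :: real ^ 'n \<Rightarrow> real) \<le> ennreal (3 * A)"
proof (rule var_norm_le)
  define s where "s x = real_of_ereal (conj_exponent p x)" for x
  define m where "m = 3 * A"
  have m: "0 < m" using A by (simp add: m_def)
  have pm [measurable]: "p \<in> borel_measurable lebesgue" and p1: "\<And>x. 1 \<le> p x"
    using p by (auto simp: exponent_function_def)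
  note measurable_conj_exponent[OF pm, measurable]
  have sm [measurable]: "s \<in> borel_measurable lebesgue" unfolding s_def by measurable
  have Qm [measurable]: "Q \<in> sets lebesgue" using Q by (simp add: compact_imp_closed borel_closed)
  have Qfin: "emeasure lebesgue Q < \<infinity>"
    using fmeasurableD2[OF lmeasurable_compact[OF Q]] by (simp add: less_top)
  have conj_inf: "conj_exponent p x = \<infinity> \<longleftrightarrow> p x = 1" for x
    using p1[of x] by (cases "p x") (auto simp: conj_exponent_def one_ereal_def divide_ereal_def)
  have s1: "1 \<le> s x" if "p x \<noteq> 1" for x
    using conj_exponent_ge_1[of p x] p1[of x] that conj_inf[of x] unfolding s_def
    by (cases "conj_exponent p x") auto
  have sp: "(1 - s x) * real_of_ereal (p x) = - s x" if "p x \<noteq> 1" "p x \<noteq> \<infinity>" for x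
    using p1[of x] that unfolding s_def
    by (cases "p x") (auto simp: conj_exponent_def one_ereal_def divide_ereal_def field_simps)
  have s_top: "s x = 1" if "p x = \<infinity>" for x
    using that by (simp add: s_def conj_exponent_def one_ereal_def divide_ereal_def)
  \<comment> \<open>The cut-off \<open>p' \<le> M\<close> keeps \<open>m powr (1 - p')\<close> bounded when \<open>m < 1\<close>.\<close>
  define E where "E M = {x \<in> Q. p x \<noteq> 1 \<and> s x \<le> real M}" for M :: nat
  have Em [measurable]: "E M \<in> sets lebesgue" for M
  proof -
    have "E M = Q \<inter> {x \<in> space lebesgue. p x \<noteq> 1 \<and> s x \<le> real M}" by (auto simp: E_def)
    also have "\<dots> \<in> sets lebesgue" by measurable
    finally show ?thesis .
  qed
  have half: "(\<integral>\<^sup>+x. ennreal (m powr - s x) * indicator (E M) x \<partial>lebesgue) \<le> ennreal (1 / 2)" for M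
  proof -
    define h where "h x = m powr - s x * indicator (E M) x" for x
    define g where "g x = m * h x" for x
    have bound: "m powr - s x \<le> 1 + m powr - real M" if "x \<in> E M" for x
    proof (cases "1 \<le> m")
      case True
      then have "m powr - s x \<le> m powr 0"
        using s1[of x] that by (intro powr_mono) (auto simp: E_def)
      then show ?thesis using m by (simp add: add_increasing2)
    next
      case False
      then have "m powr - s x \<le> m powr - real M"
        using that m by (intro powr_mono') (auto simp: E_def)
      then show ?thesis by simp
    qed
    have h: "test_function Q h"
      unfolding test_function_def
    proof (intro conjI allI exI)
      show "h x \<le> 1 + m powr - real M" for x
        using bound[of x] by (auto simp: h_def indicator_def add_nonneg_nonneg)
      show "h \<in> borel_measurable lebesgue" unfolding h_def by measurable
    qed (auto simp: h_def E_def)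
    then have hi: "integrable lebesgue h" by (rule integrable_test_function[OF Q])
    have h0: "\<And>x. 0 \<le> h x" by (simp add: h_def)
    define S where "S = (LINT x|lebesgue. h x)"
    have S0: "0 \<le> S" using h0 by (simp add: S_def integral_nonneg_AE)
    have S: "(\<integral>\<^sup>+x. ennreal (h x) \<partial>lebesgue) = ennreal S"
      unfolding S_def using hi h0 by (intro nn_integral_eq_integral) auto
    have g: "test_function Q g"
      unfolding g_def using h m by (intro test_function_cmult) auto
    have gm: "g \<in> borel_measurable lebesgue" using g by (simp add: test_function_def)
    have geq: "g x = m powr (1 - s x) * indicator (E M) x" for x
      using m by (simp add: g_def h_def powr_diff powr_minus field_simps)
    \<comment> \<open>The additional \<open>1\<close> pays for the set where \<open>p = \<infinity>\<close>, on which \<open>p' = 1\<close> and \<open>g \<le> 1\<close>.\<close>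
    have "modular p g \<le> ennreal (S + 1)"
    proof (rule modular_le[OF pm gm])
      have "norm (g x) powr real_of_ereal (p x) = h x" if "p x \<noteq> \<infinity>" for x
        using sp[OF _ that] m by (auto simp: geq h_def indicator_def powr_powr E_def)
      then have "(\<integral>\<^sup>+ x \<in> {x. p x \<noteq> \<infinity>}. ennreal (norm (g x) powr real_of_ereal (p x)) \<partial>lebesgue)
         \<le> (\<integral>\<^sup>+x. ennreal (h x) \<partial>lebesgue)"
        by (intro nn_integral_mono) (auto simp: indicator_def)
      then show "(\<integral>\<^sup>+ x \<in> {x. p x \<noteq> \<infinity>}. ennreal (norm (g x) powr real_of_ereal (p x)) \<partial>lebesgue) \<le> ennreal S"
        by (simp add: S)
      show "AE x in lebesgue. p x = \<infinity> \<longrightarrow> ennreal (norm (g x)) \<le> 1"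
        using s_top m by (intro AE_I2) (auto simp: geq indicator_def)
    qed (use S0 in simp)
    then have "var_norm p g \<le> ennreal (S + 1)"
      using S0 gm by (intro var_norm_le_of_modular_le[OF p]) auto
    then have "ennreal A * var_norm p g \<le> ennreal (A * (S + 1))"
      using A S0 by (simp add: ennreal_mult' mult_left_mono)
    with dual[OF g] have "ennreal (LINT x|lebesgue. g x) \<le> ennreal (A * (S + 1))"
      by (rule order_trans)
    then have "m * S \<le> A * (S + 1)"
      using A S0 by (simp add: g_def S_def)
    then have "A * (2 * S) \<le> A * 1" by (simp add: m_def algebra_simps)
    then have "S \<le> 1 / 2" using A by simp
    moreover have "(\<integral>\<^sup>+x. ennreal (m powr - s x) * indicator (E M) x \<partial>lebesgue) = ennreal S"
      unfolding S[symmetric] h_def by (intro nn_integral_cong) (auto simp: indicator_def)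
    ultimately show ?thesis by (simp only: ennreal_leI)
  qed
  have "(\<integral>\<^sup>+x. ennreal (m powr - s x) * indicator {x \<in> Q. p x \<noteq> 1} x \<partial>lebesgue)
      = (\<integral>\<^sup>+x. (SUP M. ennreal (m powr - s x) * indicator (E M) x) \<partial>lebesgue)"
  proof (rule nn_integral_cong)
    fix x
    obtain M where M: "s x \<le> real M" using real_arch_simple by blast
    show "ennreal (m powr - s x) * indicator {x \<in> Q. p x \<noteq> 1} x
        = (SUP M. ennreal (m powr - s x) * indicator (E M) x)"
    proof (rule antisym)
      show "ennreal (m powr - s x) * indicator {x \<in> Q. p x \<noteq> 1} x
        \<le> (SUP M. ennreal (m powr - s x) * indicator (E M) x)"
        using M by (intro SUP_upper2[of M]) (auto simp: E_def indicator_def)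
    qed (auto intro!: SUP_least simp: E_def indicator_def)
  qed
  also have "\<dots> = (SUP M. \<integral>\<^sup>+x. ennreal (m powr - s x) * indicator (E M) x \<partial>lebesgue)"
    by (intro nn_integral_monotone_convergence_SUP)
       (auto simp: incseq_def le_fun_def E_def indicator_def)
  also have "\<dots> \<le> ennreal (1 / 2)" using half by (intro SUP_least) auto
  finally have main: "(\<integral>\<^sup>+x. ennreal (m powr - s x) * indicator {x \<in> Q. p x \<noteq> 1} x \<partial>lebesgue) \<le> ennreal (1 / 2)" .

  \<comment> \<open>For \<open>A < 1\<close> the set where \<open>p = 1\<close> meets \<open>Q\<close> in a null set: the norm of its indicator
    is at most its measure, which is the integral.\<close>
  have one: "AE x in lebesgue. p x = 1 \<longrightarrow> indicator Q x / m \<le> (1 / 2 :: real)"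
  proof (cases "1 \<le> A")
    case True
    then show ?thesis using A by (intro AE_I2) (auto simp: m_def indicator_def)
  next
    case False
    define F where "F = {x \<in> Q. p x = 1}"
    have Fm [measurable]: "F \<in> sets lebesgue"
    proof -
      have "F = Q \<inter> {x \<in> space lebesgue. p x = 1}" by (auto simp: F_def)
      also have "\<dots> \<in> sets lebesgue" by measurable
      finally show ?thesis .
    qed
    have Ffin: "emeasure lebesgue F < \<infinity>"
      using Qfin emeasure_mono[of F Q lebesgue] Qm by (auto simp: F_def)
    define r where "r = measure lebesgue F"
    have r: "emeasure lebesgue F = ennreal r"
      using Ffin by (simp add: r_def emeasure_eq_ennreal_measure less_top)
    have testF: "test_function Q (indicator F)"
      unfolding test_function_def by (auto simp: F_def indicator_def intro!: exI[of _ 1])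
    have "r = 0"
    proof (rule ccontr)
      assume "r \<noteq> 0"
      then have r0: "0 < r" by (simp add: r_def less_le)
      have "modular p (\<lambda>x. indicator F x /\<^sub>R r :: real) \<le> 1"
      proof (rule modular_le[OF pm])
        have "(\<integral>\<^sup>+ x \<in> {x. p x \<noteq> \<infinity>}. ennreal (norm (indicator F x /\<^sub>R r :: real) powr real_of_ereal (p x)) \<partial>lebesgue)
           \<le> (\<integral>\<^sup>+ x. ennreal (inverse r) * indicator F x \<partial>lebesgue)"
          using r0 by (intro nn_integral_mono) (auto simp: F_def indicator_def)
        also have "\<dots> = ennreal (inverse r) * ennreal r"
          by (subst nn_integral_cmult_indicator) (auto simp: r)
        also have "\<dots> = 1" using r0 by (simp add: ennreal_mult'[symmetric])
        finally show "(\<integral>\<^sup>+ x \<in> {x. p x \<noteq> \<infinity>}. ennreal (norm (indicator F x /\<^sub>R r :: real) powr real_of_ereal (p x)) \<partial>lebesgue) \<le> 1" .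
        show "AE x in lebesgue. p x = \<infinity> \<longrightarrow> ennreal (norm (indicator F x /\<^sub>R r :: real)) \<le> 0"
          by (intro AE_I2) (auto simp: F_def indicator_def)
      qed auto
      then have "var_norm p (indicator F :: real ^ 'n \<Rightarrow> real) \<le> ennreal r"
        by (rule var_norm_le[OF r0])
      then have "ennreal A * var_norm p (indicator F :: real ^ 'n \<Rightarrow> real) \<le> ennreal (A * r)"
        using A r0 by (simp add: ennreal_mult' mult_left_mono)
      with dual[OF testF] have "ennreal r \<le> ennreal (A * r)"
        by (simp add: r_def)
      then show False using r0 A False by simp
    qed
    then have "F \<in> null_sets lebesgue" using r by auto
    then show ?thesis
      by (rule AE_mp[OF AE_not_in]) (auto simp: F_def indicator_def)
  qed

  show "0 < 3 * A" using A by simp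
  show "modular (conj_exponent p) (\<lambda>x. indicator Q x /\<^sub>R (3 * A) :: real) \<le> 1"
    unfolding m_def[symmetric]
  proof (rule modular_le)
    have "ennreal (norm (indicator Q x /\<^sub>R m :: real) powr real_of_ereal (conj_exponent p x))
        * indicator {x. conj_exponent p x \<noteq> \<infinity>} x
      = ennreal (m powr - s x) * indicator {x \<in> Q. p x \<noteq> 1} x" for x
      using m s1[of x]
      by (auto simp: indicator_def conj_inf powr_minus inverse_powr s_def[symmetric])
    then show "(\<integral>\<^sup>+ x \<in> {x. conj_exponent p x \<noteq> \<infinity>}. ennreal (norm (indicator Q x /\<^sub>R m :: real) powr real_of_ereal (conj_exponent p x)) \<partial>lebesgue) \<le> ennreal (1 / 2)"
      using main by simp
    show "AE x in lebesgue. conj_exponent p x = \<infinity> \<longrightarrow> ennreal (norm (indicator Q x /\<^sub>R m :: real)) \<le> ennreal (1 / 2)"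
    proof (rule eventually_mono[OF one])
      fix x
      assume "p x = 1 \<longrightarrow> indicator Q x / m \<le> (1 / 2 :: real)"
      moreover have "norm (indicator Q x /\<^sub>R m :: real) = indicator Q x / m"
        using m by (simp add: divide_inverse mult.commute)
      ultimately show "conj_exponent p x = \<infinity> \<longrightarrow> ennreal (norm (indicator Q x /\<^sub>R m :: real)) \<le> ennreal (1 / 2)"
        unfolding conj_inf by (metis ennreal_leI)
    qed
    have "ennreal (1 / 2) + ennreal (1 / 2) = ennreal (1 / 2 + 1 / 2)" by (subst ennreal_plus) auto
    then show "ennreal (1 / 2) + ennreal (1 / 2) \<le> 1" by simp
  qed auto
qed

section \<open>Hoelder inequality for indicators\<close>

text \<open>
  Young's inequality with weights \<open>P / R\<close> and \<open>\<beta> * P\<close>, which add up to \<open>1\<close>, applied to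
  \<open>l powr (- R)\<close> and \<open>1 / M\<close>.
\<close>

lemma powr_gap_le:
  fixes M l \<beta> P R :: real
  assumes M: "0 < M" and l: "0 < l" and \<beta>: "0 \<le> \<beta>" and P: "1 \<le> P" and R: "1 \<le> R"
    and gap: "1 / P - 1 / R = \<beta>"
  shows "(M powr \<beta> * l) powr - P \<le> l powr - R + 1 / M"
proof -
  have PR: "P / R + \<beta> * P = 1"
    using gap P R by (auto simp: field_simps)
  have "0 \<le> P / R" "0 \<le> \<beta> * P" using P R \<beta> by auto
  then have PR1: "P / R \<le> 1" "\<beta> * P \<le> 1" using PR by linarith+
  have "(M powr \<beta> * l) powr - P = (l powr - R) powr (P / R) * (1 / M) powr (\<beta> * P)"
    using M l P R by (simp add: powr_mult powr_powr powr_minus powr_divide field_simps)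
  also have "\<dots> \<le> P / R * l powr - R + \<beta> * P * (1 / M)"
    using M l P R \<beta> PR by (intro Youngs_inequality_0) auto
  also have "\<dots> \<le> 1 * l powr - R + 1 * (1 / M)"
    using M PR1 by (intro add_mono mult_right_mono) auto
  finally show ?thesis by simp
qed

lemma two_powr_neg_le_half:
  assumes "1 \<le> P" shows "(2::real) powr - P \<le> 1 / 2"
  using powr_mono[of "- P" "- 1" "2::real"] assms by (simp add: powr_minus)

text \<open>
  Hoelder's inequality for \<open>\<chi>\<^sub>Q = \<chi>\<^sub>Q * \<chi>\<^sub>Q\<close> with exponents \<open>q\<close> and \<open>1 / \<beta>\<close>, where the second factor has norm
  \<open>M powr \<beta>\<close>. If \<open>l\<close> is admissible for the norm with exponent \<open>q\<close>, integrating Young's inequality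
  over \<open>Q\<close> produces at most \<open>1 + 1\<close>, and the factor \<open>2\<close> in the constant halves it. Where \<open>q\<close> is
  infinite but \<open>p\<close> is not, admissibility gives \<open>l \<ge> 1\<close>; where \<open>p\<close> is infinite, \<open>\<beta> = 0\<close> and the two
  exponents agree.
\<close>

lemma var_norm_indicator_exponent_gap_le:
  fixes p q :: "real ^ 'n \<Rightarrow> ereal"
  assumes p: "exponent_function p" and q: "exponent_function q" and \<beta>: "0 \<le> \<beta>"
    and gap: "AE x in lebesgue. 1 / p x - 1 / q x = ereal \<beta>"
    and Qm [measurable]: "Q \<in> sets lebesgue" and QM: "emeasure lebesgue Q = ennreal M" and M: "0 < M"
  shows "var_norm p (indicator Q :: real ^ 'n \<Rightarrow> real)
     \<le> ennreal (2 * M powr \<beta>) * var_norm q (indicator Q :: real ^ 'n \<Rightarrow> real)"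
proof -
  have pm [measurable]: "p \<in> borel_measurable lebesgue" and p1: "\<And>x. 1 \<le> p x"
    using p by (auto simp: exponent_function_def)
  have qm [measurable]: "q \<in> borel_measurable lebesgue" and q1: "\<And>x. 1 \<le> q x"
    using q by (auto simp: exponent_function_def)
  define c where "c = 2 * M powr \<beta>"
  have c: "0 < c" using M by (simp add: c_def)
  have hm: "ennreal (1 / 2) * ennreal z = ennreal (1 / 2 * z)" for z
    by (rule ennreal_mult'[symmetric]) simp
  have adm: "var_norm p (indicator Q :: real ^ 'n \<Rightarrow> real) \<le> ennreal (c * l)"
    if l: "0 < l" and mod: "modular q (\<lambda>x. indicator Q x /\<^sub>R l :: real) \<le> 1" for l
  proof (rule var_norm_le)
    show cl: "0 < c * l" using c l by simp
    define F where "F x = ennreal (norm (indicator Q x /\<^sub>R l :: real) powr real_of_ereal (q x))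
       * indicator {x. q x \<noteq> \<infinity>} x" for x
    define e where "e = esssup (restrict_space lebesgue {x. q x = \<infinity>}) (\<lambda>x. ennreal (norm (indicator Q x /\<^sub>R l :: real)))"
    have Fe: "(\<integral>\<^sup>+x. F x \<partial>lebesgue) + e \<le> 1"
      using mod by (simp add: modular_def F_def e_def)
    have Fm [measurable]: "F \<in> borel_measurable lebesgue" unfolding F_def by measurable
    have ess: "AE x in lebesgue. q x = \<infinity> \<longrightarrow> ennreal (norm (indicator Q x /\<^sub>R l :: real)) \<le> e"
      unfolding e_def by (rule AE_le_modular_esssup[OF qm])
    show "modular p (\<lambda>x. indicator Q x /\<^sub>R (c * l) :: real) \<le> 1"
    proof (rule modular_le[OF pm])
      have "AE x in lebesgue. ennreal (norm (indicator Q x /\<^sub>R (c * l) :: real) powr real_of_ereal (p x))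
          * indicator {x. p x \<noteq> \<infinity>} x \<le> ennreal (1 / 2) * (F x + ennreal (1 / M) * indicator Q x)"
        using gap ess
      proof eventually_elim
        case (elim x)
        show ?case
        proof (cases "x \<in> Q \<and> p x \<noteq> \<infinity>")
          case True
          then obtain P where P: "p x = ereal P" "1 \<le> P"
            using p1[of x] by (cases "p x") auto
          have half: "(c * l) powr - P \<le> 1 / 2 * (M powr \<beta> * l) powr - P"
            using mult_right_mono[OF two_powr_neg_le_half[OF P(2)], of "(M powr \<beta> * l) powr - P"] M l
            by (simp add: c_def powr_mult mult.assoc)
          have LHS: "ennreal (norm (indicator Q x /\<^sub>R (c * l) :: real) powr real_of_ereal (p x))
            * indicator {x. p x \<noteq> \<infinity>} x = ennreal ((c * l) powr - P)"
          proof -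
            have "norm (indicator Q x /\<^sub>R (c * l) :: real) = inverse (c * l)"
              using True c l by (simp add: abs_mult)
            then show ?thesis
              using True P cl by (simp add: powr_minus inverse_powr del: inverse_mult_distrib)
          qed
          show ?thesis
          proof (cases "q x")
            case (real R)
            then have R: "1 \<le> R" using q1[of x] by simp
            have "1 / P - 1 / R = \<beta>"
              using elim(1) P R real by (simp add: one_ereal_def)
            from powr_gap_le[OF M l \<beta> P(2) R this]
            have "(c * l) powr - P \<le> 1 / 2 * (l powr - R + 1 / M)" using half by simp
            moreover have "F x = ennreal (l powr - R)"
              using True real l by (simp add: F_def powr_minus inverse_powr)
            then have "F x + ennreal (1 / M) * indicator Q x = ennreal (l powr - R + 1 / M)"
              using True M by simp
            ultimately show ?thesis
              unfolding LHS by (simp only: hm ennreal_leI)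
          next
            case PInf
            then have "ennreal (1 / l) \<le> e" using elim(2) True l by (simp add: divide_inverse)
            also have "e \<le> 1" using Fe by (metis add.commute le_iff_add order_trans)
            finally have l1: "1 \<le> l" using l by (simp add: field_simps)
            have "\<beta> * P = 1" using elim(1) P PInf by (auto simp: one_ereal_def field_simps)
            then have "(M powr \<beta> * l) powr - P = 1 / M * l powr - P"
              using M l by (simp add: powr_mult powr_powr powr_minus field_simps)
            also have "\<dots> \<le> 1 / M * 1"
              using M l1 P powr_mono[of "- P" 0 l] by (intro mult_left_mono) auto
            finally have "(c * l) powr - P \<le> 1 / 2 * (1 / M)" using half by simp
            moreover have "F x = 0" using PInf by (simp add: F_def)
            then have "F x + ennreal (1 / M) * indicator Q x = ennreal (1 / M)"
              using True by simp
            ultimately show ?thesis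
              unfolding LHS by (simp only: hm ennreal_leI)
          qed (use q1[of x] in simp)
        qed (auto simp: indicator_def)
      qed
      then have "(\<integral>\<^sup>+ x \<in> {x. p x \<noteq> \<infinity>}. ennreal (norm (indicator Q x /\<^sub>R (c * l) :: real) powr real_of_ereal (p x)) \<partial>lebesgue)
        \<le> (\<integral>\<^sup>+x. ennreal (1 / 2) * (F x + ennreal (1 / M) * indicator Q x) \<partial>lebesgue)"
        by (rule nn_integral_mono_AE)
      also have "\<dots> = ennreal (1 / 2) * ((\<integral>\<^sup>+x. F x \<partial>lebesgue) + (\<integral>\<^sup>+x. ennreal (1 / M) * indicator Q x \<partial>lebesgue))"
        by (subst nn_integral_cmult, measurable, subst nn_integral_add, measurable)
      also have "(\<integral>\<^sup>+x. ennreal (1 / M) * indicator Q x \<partial>lebesgue) = 1"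
        using M by (subst nn_integral_cmult_indicator) (auto simp: QM ennreal_mult'[symmetric])
      finally show "(\<integral>\<^sup>+ x \<in> {x. p x \<noteq> \<infinity>}. ennreal (norm (indicator Q x /\<^sub>R (c * l) :: real) powr real_of_ereal (p x)) \<partial>lebesgue)
        \<le> ennreal (1 / 2) * ((\<integral>\<^sup>+x. F x \<partial>lebesgue) + 1)" .
      show "AE x in lebesgue. p x = \<infinity> \<longrightarrow> ennreal (norm (indicator Q x /\<^sub>R (c * l) :: real)) \<le> ennreal (1 / 2) * e"
        using gap ess
      proof eventually_elim
        case (elim x)
        show ?case
        proof
          assume px: "p x = \<infinity>"
          then have "q x = \<infinity> \<and> \<beta> = 0"
            using elim(1) q1[of x] \<beta> by (cases "q x") (auto simp: one_ereal_def)
          then have "c = 2" and le: "ennreal (norm (indicator Q x /\<^sub>R l :: real)) \<le> e"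
            using elim(2) M by (auto simp: c_def)
          then have "norm (indicator Q x /\<^sub>R (c * l) :: real) = 1 / 2 * norm (indicator Q x /\<^sub>R l :: real)"
            by simp
          then have "ennreal (norm (indicator Q x /\<^sub>R (c * l) :: real))
              = ennreal (1 / 2) * ennreal (norm (indicator Q x /\<^sub>R l :: real))"
            by (simp only: ennreal_mult'[symmetric] norm_ge_zero)
          also have "\<dots> \<le> ennreal (1 / 2) * e" using le by (rule mult_left_mono) simp
          finally show "ennreal (norm (indicator Q x /\<^sub>R (c * l) :: real)) \<le> ennreal (1 / 2) * e" .
        qed
      qed
      have "ennreal (1 / 2) * ((\<integral>\<^sup>+x. F x \<partial>lebesgue) + 1) + ennreal (1 / 2) * e
          = ennreal (1 / 2) * (((\<integral>\<^sup>+x. F x \<partial>lebesgue) + e) + 1)"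
        by (simp add: distrib_left add_ac)
      also have "\<dots> \<le> ennreal (1 / 2) * (1 + 1)"
        by (intro mult_left_mono add_right_mono Fe) simp
      also have "\<dots> = ennreal (1 / 2) * ennreal 2" by simp
      also have "\<dots> = 1" unfolding hm by simp
      finally show "ennreal (1 / 2) * ((\<integral>\<^sup>+x. F x \<partial>lebesgue) + 1) + ennreal (1 / 2) * e \<le> 1" .
    qed auto
  qed
  have inv: "ennreal c * (ennreal (inverse c) * x) = x" "ennreal (inverse c) * (ennreal c * x) = x" for x
    using c by (simp_all add: mult.assoc[symmetric] ennreal_mult'[symmetric])
  have "ennreal (inverse c) * var_norm p (indicator Q :: real ^ 'n \<Rightarrow> real) \<le> var_norm q (indicator Q :: real ^ 'n \<Rightarrow> real)"
    unfolding var_norm_def[of q]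
  proof (rule Inf_greatest, clarify)
    fix l :: real
    assume "0 < l" "modular q (\<lambda>x. indicator Q x /\<^sub>R l :: real) \<le> 1"
    from mult_left_mono[OF adm[OF this], of "ennreal (inverse c)"] c
    show "ennreal (inverse c) * var_norm p (indicator Q :: real ^ 'n \<Rightarrow> real) \<le> ennreal l"
      by (simp add: ennreal_mult' inv)
  qed
  from mult_left_mono[OF this, of "ennreal c"] show ?thesis
    by (simp add: inv c_def[symmetric])
qed

section \<open>From the weak-type inequality to the condition on cubes\<close>

text \<open>
  On the whole cube at \<open>a\<close> the operator applied to \<open>g\<close> exceeds half of the lower bound
  given by the kernel, so that cube lies in a level set to which the weak-type inequality applies.
\<close>

lemma weak_type_far_cubes:
  fixes p q :: "real ^ 'n \<Rightarrow> ereal"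
    and K :: "real ^ 'n \<Rightarrow> real ^ 'n \<Rightarrow> 'b::{real_normed_field, euclidean_space}"
    and T :: "(real ^ 'n \<Rightarrow> 'b) \<Rightarrow> real ^ 'n \<Rightarrow> 'b"
  assumes \<alpha>: "\<alpha> < real CARD('n)"
    and p: "exponent_function p" and q: "exponent_function q"
    and T: "frac_CZ_operator \<alpha> K T" and K: "nondegenerate_kernel \<alpha> K" and weak: "weak_type p q T"
  obtains D v where "0 < D"
    and "\<And>l a b g. 0 < l \<Longrightarrow> a - b = l *\<^sub>R v \<or> b - a = l *\<^sub>R v \<Longrightarrow> test_function (cube b l) g \<Longrightarrow>
      ennreal (l powr (\<alpha> - real CARD('n)) * (LINT x|lebesgue. g x))
        * var_norm q (indicator (cube a l) :: real ^ 'n \<Rightarrow> real) \<le> ennreal D * var_norm p g"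
proof -
  obtain C where C: "0 \<le> C" and wk: "\<And>l f. 0 < l \<Longrightarrow> f \<in> var_Lp p \<Longrightarrow>
        var_norm q (indicator {x. norm (T f x) > l} :: real ^ 'n \<Rightarrow> real)
          \<le> ennreal (C / l) * var_norm p f"
    using weak unfolding weak_type_def by blast
  have fK: "frac_CZ_kernel \<alpha> K" using T by (simp add: frac_CZ_operator_def)
  obtain c v where c: "0 < c"
    and far: "\<And>l a b x y. 0 < l \<Longrightarrow> a - b = l *\<^sub>R v \<or> b - a = l *\<^sub>R v \<Longrightarrow> x \<in> cube a l \<Longrightarrow> y \<in> cube b l
      \<Longrightarrow> x \<noteq> y \<and> 2 * norm (K x y - K a b) \<le> norm (K a b)
          \<and> 2 * c * l powr (\<alpha> - real CARD('n)) \<le> norm (K a b)"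
    using kernel_comparable_on_far_cubes[OF \<alpha> fK K] by metis
  show thesis
  proof (rule that[of "(2 * C + 1) / c" v])
    show "0 < (2 * C + 1) / c" using C c by simp
    fix l a b g
    assume l: "0 < l" and ab: "a - b = l *\<^sub>R v \<or> b - a = l *\<^sub>R v" and g: "test_function (cube b l) g"
    define J where "J = l powr (\<alpha> - real CARD('n)) * (LINT x|lebesgue. g x)"
    have I0: "0 \<le> (LINT x|lebesgue. g x)" using g by (simp add: test_function_def integral_nonneg_AE)
    then have J0: "0 \<le> J" by (simp add: J_def)
    let ?f = "\<lambda>x. of_real (g x) :: 'b"
    let ?N = "var_norm q (indicator (cube a l) :: real ^ 'n \<Rightarrow> real)"
    have lower: "c * J \<le> norm (T ?f x)" if x: "x \<in> cube a l" for x
    proof -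
      have bmem: "b \<in> cube b l" using l by (simp add: mem_cube)
      have "c * J \<le> norm (K a b) / 2 * (LINT x|lebesgue. g x)"
        using mult_right_mono[OF _ I0, of "2 * c * l powr (\<alpha> - real CARD('n))" "norm (K a b)"]
          far[OF l ab x bmem] by (simp add: J_def)
      also have "\<dots> \<le> norm (T ?f x)"
        using far[OF l ab x] by (intro frac_CZ_operator_lower_bound[OF T compact_cube _ g]) blast+
      finally show ?thesis .
    qed
    have "ennreal J * ?N \<le> ennreal ((2 * C + 1) / c) * var_norm p g"
    proof (cases "J = 0")
      case False
      with J0 have J: "0 < J" by simp
      \<comment> \<open>The level set is defined by a strict inequality, hence half of the lower bound.\<close>
      define m where "m = c * J / 2"
      have m: "0 < m" using c J by (simp add: m_def)
      have sub: "cube a l \<subseteq> {x. norm (T ?f x) > m}"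
        using lower m by (force simp: m_def)
      have "?N \<le> var_norm q (indicator {x. norm (T ?f x) > m} :: real ^ 'n \<Rightarrow> real)"
      proof (rule var_norm_mono)
        show "0 \<le> q x" for x using q order_trans[of 0 1 "q x"] by (simp add: exponent_function_def)
      qed (use sub in \<open>auto simp: indicator_def\<close>)
      also have "\<dots> \<le> ennreal (C / m) * var_norm p ?f"
        by (rule wk[OF m test_function_in_var_Lp[OF p compact_cube g]])
      also have "var_norm p ?f = var_norm p g"
        by (rule var_norm_cong_norm) simp
      finally have "ennreal J * ?N \<le> ennreal J * (ennreal (C / m) * var_norm p g)"
        by (rule mult_left_mono) simp
      also have "\<dots> = ennreal (J * (C / m)) * var_norm p g"
        by (simp only: ennreal_mult'[OF J0] mult.assoc)
      also have "J * (C / m) = 2 * C / c" using J c by (simp add: m_def)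
      also have "ennreal (2 * C / c) * var_norm p g \<le> ennreal ((2 * C + 1) / c) * var_norm p g"
        using c by (intro mult_right_mono ennreal_leI divide_right_mono) auto
      finally show ?thesis .
    qed simp
    then show "ennreal (l powr (\<alpha> - real CARD('n)) * (LINT x|lebesgue. g x)) * ?N
       \<le> ennreal ((2 * C + 1) / c) * var_norm p g" by (simp add: J_def)
  qed
qed

theorem theorem1p6:
  fixes \<alpha> :: real
    and p q :: "real ^ 'n \<Rightarrow> ereal"
    and K :: "real ^ 'n \<Rightarrow> real ^ 'n \<Rightarrow> 'b::{real_normed_field, euclidean_space}"
    and T :: "(real ^ 'n \<Rightarrow> 'b) \<Rightarrow> real ^ 'n \<Rightarrow> 'b"
  assumes "0 \<le> \<alpha>" and "\<alpha> < real CARD('n)"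
    and "exponent_function p"
    and "esssup lebesgue p \<le> ereal (real CARD('n)) / ereal \<alpha>"
    and "exponent_function q"
    and "\<And>x. p x \<le> ereal (real CARD('n)) / ereal \<alpha>
           \<Longrightarrow> 1 / p x - 1 / q x = ereal (\<alpha> / real CARD('n))"
    and "frac_CZ_operator \<alpha> K T"
    and "nondegenerate_kernel \<alpha> K"
    and "weak_type p q T"
  shows "K0_class \<alpha> p q"
proof -
  note p = assms(3) and q = assms(5)
  have gap: "AE x in lebesgue. 1 / p x - 1 / q x = ereal (\<alpha> / real CARD('n))"
    using esssup_AE[of p lebesgue]
    by (rule eventually_mono) (use assms(4,6) in \<open>blast intro: order_trans\<close>)
  obtain D v where D: "0 < D" and far: "\<And>l a b g. 0 < l \<Longrightarrow> a - b = l *\<^sub>R v \<or> b - a = l *\<^sub>R v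
      \<Longrightarrow> test_function (cube b l) g \<Longrightarrow>
      ennreal (l powr (\<alpha> - real CARD('n)) * (LINT x|lebesgue. g x))
        * var_norm q (indicator (cube a l) :: real ^ 'n \<Rightarrow> real) \<le> ennreal D * var_norm p g"
    using weak_type_far_cubes[OF assms(2) p q assms(7-9)] by metis
  have bound: "ennreal (measure lebesgue (cube a l) powr (\<alpha> / real CARD('n) - 1))
        * var_norm (conj_exponent p) (indicator (cube a l) :: real ^ 'n \<Rightarrow> real)
        * var_norm q (indicator (cube a l) :: real ^ 'n \<Rightarrow> real) \<le> ennreal (6 * D\<^sup>2)"
    if l: "0 < l" for a :: "real ^ 'n" and l
  proof -
    define b where "b = a + l *\<^sub>R v"
    have ab: "a - b = l *\<^sub>R v \<or> b - a = l *\<^sub>R v" "b - a = l *\<^sub>R v \<or> a - b = l *\<^sub>R v"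
      by (auto simp: b_def)
    define w where "w = l powr (\<alpha> - real CARD('n))"
    have w: "0 < w" using l by (simp add: w_def)
    let ?N = "\<lambda>a. var_norm q (indicator (cube a l) :: real ^ 'n \<Rightarrow> real)"
    have vol: "l ^ CARD('n) = l powr real CARD('n)" using l by (simp add: powr_realpow)
    have weight: "measure lebesgue (cube a l) powr (\<alpha> / real CARD('n) - 1) = w"
      unfolding measure_cube[OF l] vol by (simp add: powr_powr w_def right_diff_distrib)
    have "test_function (cube b l) (indicator (cube b l))"
      unfolding test_function_def by (auto simp: indicator_def intro!: exI[of _ 1])
    from far[OF l ab(1) this]
    have "ennreal (w * l ^ CARD('n)) * ?N a \<le> ennreal D * var_norm p (indicator (cube b l) :: real ^ 'n \<Rightarrow> real)"
      using measure_cube[OF l, of b] by (simp add: w_def)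
    also have "w * l ^ CARD('n) = l powr \<alpha>"
      by (simp add: w_def vol powr_add[symmetric])
    also have "var_norm p (indicator (cube b l) :: real ^ 'n \<Rightarrow> real)
        \<le> ennreal (2 * (l ^ CARD('n)) powr (\<alpha> / real CARD('n))) * ?N b"
      using assms(1) l
      by (intro var_norm_indicator_exponent_gap_le[OF p q _ gap] emeasure_cube) auto
    also have "(l ^ CARD('n)) powr (\<alpha> / real CARD('n)) = l powr \<alpha>"
      by (simp add: vol powr_powr)
    finally have "ennreal (l powr \<alpha>) * ?N a \<le> ennreal D * (ennreal (2 * l powr \<alpha>) * ?N b)"
      by (simp add: mult_left_mono)
    also have "\<dots> = ennreal (l powr \<alpha>) * (ennreal (2 * D) * ?N b)"
      using D by (simp add: ennreal_mult' mult_ac)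
    \<comment> \<open>The same exponent on both cubes: this moves the last factor of the product from one to the
      other.\<close>
    finally have swap: "?N a \<le> ennreal (2 * D) * ?N b"
      using l by (simp add: ennreal_mult_le_mult_iff)
    have "modular q (indicator (cube b l) :: real ^ 'n \<Rightarrow> real) \<le> emeasure lebesgue (cube b l) + 1"
      by (rule modular_bounded_by_one_le[OF q]) (auto simp: indicator_def)
    also have "\<dots> = ennreal (l ^ CARD('n) + 1)"
      unfolding emeasure_cube[OF l] using l by simp
    finally have "?N b \<le> ennreal (l ^ CARD('n) + 1)"
      using l by (intro var_norm_le_of_modular_le[OF q]) auto
    then obtain N where N: "?N b = ennreal N" "0 \<le> N"
      by (metis ennreal_cases ennreal_less_top leD top.extremum_unique)
    show ?thesis
    \<comment> \<open>In the degenerate case \<open>N = 0\<close> the comparison of the two cubes makes the product vanish, as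
      \<open>\<infinity> * 0 = 0\<close> in \<^typ>\<open>ennreal\<close>.\<close>
    proof (cases "N = 0")
      case True
      then have "?N a = 0" using swap N by simp
      then show ?thesis by simp
    next
      case False
      then have N0: "0 < N" using N by simp
      define A where "A = D / (w * N)"
      have A: "0 < A" using D w N0 by (simp add: A_def)
      have "var_norm (conj_exponent p) (indicator (cube a l) :: real ^ 'n \<Rightarrow> real) \<le> ennreal (3 * A)"
      proof (rule var_norm_conj_le[OF p compact_cube A])
        fix g :: "real ^ 'n \<Rightarrow> real"
        assume g: "test_function (cube a l) g"
        define I where "I = (LINT x|lebesgue. g x)"
        have I0: "0 \<le> I" using g by (simp add: I_def test_function_def integral_nonneg_AE)
        have "ennreal (w * N * I) \<le> ennreal D * var_norm p g"
          using far[OF l ab(2) g] w N I0 by (simp add: I_def w_def ennreal_mult' mult_ac)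
        then have "ennreal (1 / (w * N)) * ennreal (w * N * I) \<le> ennreal (1 / (w * N)) * (ennreal D * var_norm p g)"
          by (rule mult_left_mono) simp
        moreover have "ennreal (1 / (w * N)) * ennreal (w * N * I) = ennreal I"
          using w N0 by (simp add: ennreal_mult'[symmetric])
        moreover have "ennreal (1 / (w * N)) * (ennreal D * var_norm p g) = ennreal A * var_norm p g"
          using w N0 by (simp add: mult.assoc[symmetric] ennreal_mult'[symmetric] A_def)
        ultimately show "ennreal (LINT x|lebesgue. g x) \<le> ennreal A * var_norm p g"
          by (simp add: I_def)
      qed
      moreover have nonneg: "0 \<le> 3 * A" "0 \<le> 2 * D * N" using A D N by auto
      moreover have "?N a \<le> ennreal (2 * D * N)" using swap N D by (simp add: ennreal_mult')
      ultimately have "ennreal w * var_norm (conj_exponent p) (indicator (cube a l) :: real ^ 'n \<Rightarrow> real) * ?N a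
          \<le> ennreal w * ennreal (3 * A) * ennreal (2 * D * N)"
        by (intro mult_mono) auto
      also have "\<dots> = ennreal (w * (3 * A) * (2 * D * N))"
        by (simp only: ennreal_mult''[OF nonneg(1)] ennreal_mult''[OF nonneg(2)])
      also have "w * (3 * A) * (2 * D * N) = 6 * D\<^sup>2"
        using w N0 by (simp add: A_def power2_eq_square)
      finally show ?thesis by (simp add: weight)
    qed
  qed
  have "(SUP Q \<in> (cubes :: (real ^ 'n) set set).
        ennreal (measure lebesgue Q powr (\<alpha> / real CARD('n) - 1))
        * var_norm (conj_exponent p) (indicator Q :: real ^ 'n \<Rightarrow> real)
        * var_norm q (indicator Q :: real ^ 'n \<Rightarrow> real)) \<le> ennreal (6 * D\<^sup>2)"
  proof (rule SUP_least)
    fix Q :: "(real ^ 'n) set"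
    assume "Q \<in> cubes"
    then obtain a l where "Q = cube a l" "0 < l" by (auto simp: cubes_def cube_def)
    then show "ennreal (measure lebesgue Q powr (\<alpha> / real CARD('n) - 1))
        * var_norm (conj_exponent p) (indicator Q :: real ^ 'n \<Rightarrow> real)
        * var_norm q (indicator Q :: real ^ 'n \<Rightarrow> real) \<le> ennreal (6 * D\<^sup>2)"
      using bound by simp
  qed
  also have "\<dots> < \<infinity>" by simp
  finally show ?thesis by (simp add: K0_class_def)
qed

end
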